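(* Let $X$ be a paracompact topological space and let $G$ be a factorizable non-fixing group of homeomorphisms of $X$. Assume that the commutator length $\mathrm{cl}_G$ is bounded on $[G,G]$, and that for every open cover $\mathcal{U}$ of $X$ the group $G$ is bounded with respect to the fragmentation norm $\mathrm{frag}^{\mathcal{U}}$ (i.e. $\sup_{g\in G}\mathrm{frag}^{\mathcal{U}}(g)<\infty$). Then the commutator subgroup $[G,G]$ is uniformly perfect.
   Context: Paracompact spaces are understood to be Hausdorff. $\mathcal{H}(X)$ is the group of all homeomorphisms of $X$; a group of homeomorphisms of $X$ is a subgroup $G\leq\mathcal{H}(X)$. For $g\in\mathcal{H}(X)$, $\mathrm{supp}(g)$ is the closure of $\{x\in X: g(x)\neq x\}$. For an open cover $\mathcal{U}$ of $X$, $G$ is $\mathcal{U}$-factorizable if for every $g\in G$ there are $g_1,\ldots,g_r\in G$ and $U_1,\ldots,U_r\in\mathcal{U}$ with $g=g_1\cdots g_r$ and $\mathrm{supp}(g_i)\subset U_i$ for all $i$. $G$ is factorizable if it is $\mathcal{U}$-factorizable for every open cover $\mathcal{U}$ of $X$. $G$ is non-fixing if for every $x\in X$ the orbit $\{g(x): g\in G\}$ is different from $\{x\}$. If $G$ is $\mathcal{U}$-factorizable, then for $g\in G$, $g\ne\mathrm{id}$, $\mathrm{frag}^{\mathcal{U}}(g)$ is the least integer $\rho>0$ such that $g=g_1\cdots g_\rho$ with $g_i\in G$ and $\mathrm{supp}(g_i)\subset U_i$ for some $U_i\in\mathcal{U}$, $i=1,\ldots,\rho$; $\mathrm{frag}^{\mathcal{U}}(\mathrm{id})=0$.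 $[f,g]=fgf^{-1}g^{-1}$, and $[G,G]$ is the commutator subgroup. For $g\in[G,G]$, $g\neq e$, $\mathrm{cl}_G(g)$ is the least $r$ such that $g$ is a product of $r$ commutators of elements of $G$; $\mathrm{cl}_G(e)=0$. A group $H$ is uniformly perfect if $H=[H,H]$ and there is a positive integer $r$ such that every element of $H$ is a product of at most $r$ commutators of elements of $H$. *)

theory Defs
  imports "HOL-Analysis.Analysis" "HOL-Algebra.Bij" "HOL-Algebra.Generated_Groups"
begin

definition open_cover :: "'a topology \<Rightarrow> 'a set set \<Rightarrow> bool" where
  "open_cover X \<U> \<longleftrightarrow> (\<forall>U\<in>\<U>. openin X U) \<and> \<Union>\<U> = topspace X"

definition paracompact_space :: "'a topology \<Rightarrow> bool" where
  "paracompact_space X \<longleftrightarrow> Hausdorff_space X \<and>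
     (\<forall>\<U>. open_cover X \<U> \<longrightarrow>
        (\<exists>\<V>. open_cover X \<V> \<and> (\<forall>V\<in>\<V>. \<exists>U\<in>\<U>. V \<subseteq> U) \<and> locally_finite_in X \<V>))"

text \<open>As in \<^const>\<open>BijGroup\<close>, homeomorphisms are represented by functions that are
  \<^const>\<open>undefined\<close> outside the space, so that each has exactly one representative.\<close>

definition homeo_group :: "'a topology \<Rightarrow> ('a \<Rightarrow> 'a) monoid" where
  "homeo_group X =
     (BijGroup (topspace X))\<lparr>carrier := {f \<in> Bij (topspace X). homeomorphic_map X X f}\<rparr>"

lemma subgroup_homeo_BijGroup:
  "subgroup {f \<in> Bij (topspace X). homeomorphic_map X X f} (BijGroup (topspace X))"
proof -
  let ?S = "topspace X"
  let ?H = "{f \<in> Bij ?S. homeomorphic_map X X f}"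
  interpret B: group "BijGroup ?S" by (rule group_BijGroup)
  show ?thesis
  proof (rule B.subgroupI)
    show "?H \<subseteq> carrier (BijGroup ?S)"
      by (auto simp: BijGroup_def)
    have "homeomorphic_map X X (\<lambda>x\<in>?S. x)"
      by (auto simp: homeomorphic_map_maps homeomorphic_maps_def intro!: exI[of _ "\<lambda>x. x"])
    then show "?H \<noteq> {}" using id_Bij by blast
  next
    fix f assume f: "f \<in> ?H"
    then have fB: "f \<in> Bij ?S" and fh: "homeomorphic_map X X f" by auto
    let ?g = "\<lambda>x\<in>?S. inv_into ?S f x"
    have gB: "?g \<in> Bij ?S" using fB by (rule restrict_inv_into_Bij)
    have "?g \<otimes>\<^bsub>BijGroup ?S\<^esub> f = \<one>\<^bsub>BijGroup ?S\<^esub>"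
      using fB gB by (simp add: BijGroup_def Bij_compose_restrict_eq)
    then have eq: "inv\<^bsub>BijGroup ?S\<^esub> f = ?g"
      using fB gB by (intro B.inv_equality) (auto simp: BijGroup_def)
    obtain h where h: "homeomorphic_maps X X f h"
      using fh by (auto simp: homeomorphic_map_maps)
    have "?g x = h x" if "x \<in> ?S" for x
    proof -
      have "h x \<in> ?S" "f (h x) = x" "inj_on f ?S"
        using h that fB by (auto simp: homeomorphic_maps_def Bij_def bij_betw_def continuous_map_def)
      then show ?thesis using that by (metis inv_into_f_f restrict_apply')
    qed
    moreover have "homeomorphic_map X X h"
      using h homeomorphic_maps_map by blast
    ultimately have "homeomorphic_map X X ?g"
      by (metis homeomorphic_map_eq)
    then show "inv\<^bsub>BijGroup ?S\<^esub> f \<in> ?H" using gB eq by simp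
  next
    fix f g assume fg: "f \<in> ?H" "g \<in> ?H"
    have "homeomorphic_map X X (f \<circ> g)"
      using fg homeomorphic_map_compose by blast
    then have "homeomorphic_map X X (compose ?S f g)"
      by (rule homeomorphic_map_eq) (simp add: compose_def)
    then show "f \<otimes>\<^bsub>BijGroup ?S\<^esub> g \<in> ?H"
      using fg by (simp add: BijGroup_def compose_Bij)
  qed
qed

lemma group_homeo_group: "group (homeo_group X)"
  unfolding homeo_group_def
  by (rule subgroup.subgroup_is_group[OF subgroup_homeo_BijGroup group_BijGroup])

definition supp :: "'a topology \<Rightarrow> ('a \<Rightarrow> 'a) \<Rightarrow> 'a set" where
  "supp X g = X closure_of {x \<in> topspace X. g x \<noteq> x}"

definition list_product :: "('g, 'm) monoid_scheme \<Rightarrow> 'g list \<Rightarrow> 'g" where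
  "list_product M gs = foldr (\<lambda>a b. a \<otimes>\<^bsub>M\<^esub> b) gs \<one>\<^bsub>M\<^esub>"

definition is_fragmentation ::
    "'a topology \<Rightarrow> ('a \<Rightarrow> 'a) set \<Rightarrow> 'a set set \<Rightarrow> ('a \<Rightarrow> 'a) list \<Rightarrow> ('a \<Rightarrow> 'a) \<Rightarrow> bool" where
  "is_fragmentation X G \<U> gs g \<longleftrightarrow>
     set gs \<subseteq> G \<and> (\<forall>h\<in>set gs. \<exists>U\<in>\<U>. supp X h \<subseteq> U) \<and> g = list_product (homeo_group X) gs"

definition cover_factorizable :: "'a topology \<Rightarrow> ('a \<Rightarrow> 'a) set \<Rightarrow> 'a set set \<Rightarrow> bool" where
  "cover_factorizable X G \<U> \<longleftrightarrow> (\<forall>g\<in>G. \<exists>gs. is_fragmentation X G \<U> gs g)"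

definition factorizable :: "'a topology \<Rightarrow> ('a \<Rightarrow> 'a) set \<Rightarrow> bool" where
  "factorizable X G \<longleftrightarrow> (\<forall>\<U>. open_cover X \<U> \<longrightarrow> cover_factorizable X G \<U>)"

definition non_fixing :: "'a topology \<Rightarrow> ('a \<Rightarrow> 'a) set \<Rightarrow> bool" where
  "non_fixing X G \<longleftrightarrow> (\<forall>x\<in>topspace X. (\<lambda>g. g x) ` G \<noteq> {x})"

text \<open>\<^term>\<open>frag X G \<U> g\<close> is meaningful for \<open>g \<in> G\<close> when \<^term>\<open>cover_factorizable X G \<U>\<close> holds.\<close>

definition frag :: "'a topology \<Rightarrow> ('a \<Rightarrow> 'a) set \<Rightarrow> 'a set set \<Rightarrow> ('a \<Rightarrow> 'a) \<Rightarrow> nat" where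
  "frag X G \<U> g =
     (if g = \<one>\<^bsub>homeo_group X\<^esub> then 0
      else (LEAST \<rho>. \<rho> > 0 \<and> (\<exists>gs. length gs = \<rho> \<and> is_fragmentation X G \<U> gs g)))"

text \<open>The remaining notions concern a subgroup \<open>H\<close> of an ambient group \<open>M\<close>, following the
  convention of \<^const>\<open>derived\<close>: \<^term>\<open>derived M H\<close> is the commutator subgroup of \<open>H\<close>,
  and \<open>derived_set M H\<close> is the set of commutators of elements of \<open>H\<close>.\<close>

definition commutator_product :: "('g, 'm) monoid_scheme \<Rightarrow> 'g set \<Rightarrow> nat \<Rightarrow> 'g \<Rightarrow> bool" where
  "commutator_product M H r g \<longleftrightarrow>
     (\<exists>cs. length cs = r \<and> set cs \<subseteq> derived_set M H \<and> g = list_product M cs)"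

definition commutator_length :: "('g, 'm) monoid_scheme \<Rightarrow> 'g set \<Rightarrow> 'g \<Rightarrow> nat" where
  "commutator_length M H g =
     (if g = \<one>\<^bsub>M\<^esub> then 0 else (LEAST r. commutator_product M H r g))"

definition uniformly_perfect :: "('g, 'm) monoid_scheme \<Rightarrow> 'g set \<Rightarrow> bool" where
  "uniformly_perfect M H \<longleftrightarrow>
     H = derived M H \<and> (\<exists>r>0. \<forall>h\<in>H. \<exists>n\<le>r. commutator_product M H n h)"

end

theory Submission
  imports Defs
begin

text \<open>
  Non-fixing together with factorizability gives every orbit at least three points, so every point
  has a neighbourhood \<open>V\<close> with \<open>V\<close>, \<open>h(V)\<close>, \<open>k(V)\<close> pairwise disjoint for some \<open>h, k \<in> G\<close>. If \<open>f\<close> and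
  \<open>g\<close> are supported in \<open>V\<close> then \<open>[f, g] = [[f, h], [g, k]]\<close>, a commutator of elements of \<open>[G, G]\<close>.
  By paracompactness these sets \<open>V\<close> have a refinement \<open>\<W>\<close> any two meeting members of which lie in
  a common \<open>V\<close>. Hence the commutator of two \<open>\<W>\<close>-fragments is trivial or of the above form, and
  expanding \<open>[f, g]\<close> along fragmentations of \<open>f\<close> and \<open>g\<close> of length at most \<open>N\<close> gives \<open>N\<^sup>2\<close>
  conjugates of such commutators. A bound \<open>C\<close> on \<open>cl\<^sub>G\<close> then bounds the commutator length in \<open>[G, G]\<close>
  by \<open>C N\<^sup>2\<close>.
\<close>

section \<open>Products of commutators\<close>

context group
begin

text \<open>With words associated to the right by \<open>m_assoc\<close>, these rules cancel a
  letter against an adjacent inverse in front of a remaining word; the commutator identities below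
  are proved by this normalisation.\<close>

lemma inv_cancel_assoc:
  assumes "x \<in> carrier G" "y \<in> carrier G"
  shows "x \<otimes> (inv x \<otimes> y) = y" "inv x \<otimes> (x \<otimes> y) = y"
  using assms by (simp_all flip: m_assoc)

lemma list_product_closed: "set xs \<subseteq> carrier G \<Longrightarrow> list_product G xs \<in> carrier G"
  by (induction xs) (auto simp: list_product_def)

lemma list_product_append:
  assumes "set xs \<subseteq> carrier G" "set ys \<subseteq> carrier G"
  shows "list_product G (xs @ ys) = list_product G xs \<otimes> list_product G ys"
  using assms(1)
proof (induction xs)
  case Nil
  then show ?case using list_product_closed[OF assms(2)] by (simp add: list_product_def)
next
  case (Cons x xs)
  moreover have "list_product G (z # zs) = z \<otimes> list_product G zs" for z zs
    by (simp add: list_product_def)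
  ultimately show ?case
    using list_product_closed[of xs] list_product_closed[OF assms(2)] by (simp add: m_assoc)
qed

section \<open>Counting factors in products of commutators\<close>

lemma commutator_product_Nil: "commutator_product G H 0 \<one>"
  by (simp add: commutator_product_def list_product_def)

lemma commutator_product_single:
  assumes "c \<in> derived_set G H" "H \<subseteq> carrier G"
  shows "commutator_product G H 1 c"
proof -
  have "c \<in> carrier G" using assms derived_set_in_carrier by blast
  then show ?thesis
    unfolding commutator_product_def using assms(1)
    by (intro exI[of _ "[c]"]) (simp add: list_product_def)
qed

lemma commutator_product_mult:
  assumes "commutator_product G H m a" "commutator_product G H n b" "H \<subseteq> carrier G"
  shows "commutator_product G H (m + n) (a \<otimes> b)"
proof -
  note D = derived_set_in_carrier[OF assms(3)]
  obtain as bs where as: "length as = m" "set as \<subseteq> derived_set G H" "a = list_product G as"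
    and bs: "length bs = n" "set bs \<subseteq> derived_set G H" "b = list_product G bs"
    using assms unfolding commutator_product_def by blast
  show ?thesis
    unfolding commutator_product_def
  proof (intro exI conjI)
    show "length (as @ bs) = m + n" using as bs by simp
    show "set (as @ bs) \<subseteq> derived_set G H" using as(2) bs(2) by (simp only: set_append Un_least)
    show "a \<otimes> b = list_product G (as @ bs)"
      unfolding as(3) bs(3)
      by (rule list_product_append[OF subset_trans[OF as(2) D] subset_trans[OF bs(2) D], symmetric])
  qed
qed

text \<open>Substitution factor by factor, so the counts multiply. It is used with \<open>K\<close>
  the derived subgroup of \<open>H\<close>, to turn commutators over \<open>H\<close> into products
  of commutators over \<open>K\<close>.\<close>

lemma commutator_product_bind:
  assumes "commutator_product G H r a" "K \<subseteq> carrier G"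
    and "\<And>c. c \<in> derived_set G H \<Longrightarrow> \<exists>n\<le>N. commutator_product G K n c"
  shows "\<exists>n\<le>r * N. commutator_product G K n a"
proof -
  obtain cs where cs: "length cs = r" "set cs \<subseteq> derived_set G H" "a = list_product G cs"
    using assms(1) unfolding commutator_product_def by blast
  have "set cs \<subseteq> derived_set G H \<Longrightarrow>
      \<exists>n\<le>length cs * N. commutator_product G K n (list_product G cs)" for cs
  proof (induction cs)
    case Nil
    then show ?case using commutator_product_Nil by (simp add: list_product_def)
  next
    case (Cons c cs)
    then obtain m n where "m \<le> length cs * N" "commutator_product G K m (list_product G cs)"
      "n \<le> N" "commutator_product G K n c"
      using assms(3)[of c] by (simp only: list.set insert_subset) blast
    then have "commutator_product G K (n + m) (list_product G (c # cs)) \<and> n + m \<le> length (c # cs) * N"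
      using commutator_product_mult[OF _ _ assms(2)] by (simp add: list_product_def)
    then show ?case by blast
  qed
  then show ?thesis using cs by blast
qed

lemma conj_mult:
  assumes "x \<in> carrier G" "a \<in> carrier G" "b \<in> carrier G"
  shows "x \<otimes> (a \<otimes> b) \<otimes> inv x = (x \<otimes> a \<otimes> inv x) \<otimes> (x \<otimes> b \<otimes> inv x)"
  using assms by (simp add: m_assoc inv_cancel_assoc)

text \<open>Conjugation is a homomorphism, so it carries [a, b] to the commutator of the conjugates
  of a and b, which stay in \<open>K\<close>.\<close>

lemma derived_set_conj:
  assumes "c \<in> derived_set G K" "K \<subseteq> carrier G" "x \<in> carrier G"
    and "\<And>k. k \<in> K \<Longrightarrow> x \<otimes> k \<otimes> inv x \<in> K"
  shows "x \<otimes> c \<otimes> inv x \<in> derived_set G K"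
proof -
  obtain a b where ab: "a \<in> K" "b \<in> K" "c = a \<otimes> b \<otimes> inv a \<otimes> inv b"
    using assms(1) by blast
  then have "a \<in> carrier G" "b \<in> carrier G" using assms(2) by auto
  then have "x \<otimes> c \<otimes> inv x = (x \<otimes> a \<otimes> inv x) \<otimes> (x \<otimes> b \<otimes> inv x) \<otimes>
      inv (x \<otimes> a \<otimes> inv x) \<otimes> inv (x \<otimes> b \<otimes> inv x)"
    using assms(3) unfolding ab(3) by (simp add: m_assoc inv_cancel_assoc inv_mult_group)
  then show ?thesis using assms(4) ab by blast
qed

text \<open>Inserting \<open>inv x \<otimes> x\<close> between neighbouring factors conjugates each
  of them separately, so conjugation costs no extra commutators.\<close>

lemma commutator_product_conj:
  assumes "commutator_product G K n a" "K \<subseteq> carrier G" "x \<in> carrier G"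
    and "\<And>k. k \<in> K \<Longrightarrow> x \<otimes> k \<otimes> inv x \<in> K"
  shows "commutator_product G K n (x \<otimes> a \<otimes> inv x)"
proof -
  note D = derived_set_in_carrier[OF assms(2)]
  have *: "set cs \<subseteq> derived_set G K \<Longrightarrow>
      x \<otimes> list_product G cs \<otimes> inv x = list_product G (map (\<lambda>c. x \<otimes> c \<otimes> inv x) cs)" for cs
  proof (induction cs)
    case Nil
    then show ?case using assms(3) by (simp add: list_product_def)
  next
    case (Cons c cs)
    have cs: "set cs \<subseteq> derived_set G K" "c \<in> derived_set G K"
      using Cons.prems by (simp_all only: list.set insert_subset)
    then have "c \<in> carrier G" "list_product G cs \<in> carrier G"
      using D list_product_closed[OF subset_trans[OF _ D]] by blast+
    then show ?case
      using Cons.IH[OF cs(1)] conj_mult[OF assms(3)] by (simp add: list_product_def)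
  qed
  obtain cs where cs: "length cs = n" "set cs \<subseteq> derived_set G K" "a = list_product G cs"
    using assms(1) unfolding commutator_product_def by blast
  show ?thesis
    unfolding commutator_product_def
  proof (intro exI conjI)
    show "length (map (\<lambda>c. x \<otimes> c \<otimes> inv x) cs) = n" using cs by simp
    show "set (map (\<lambda>c. x \<otimes> c \<otimes> inv x) cs) \<subseteq> derived_set G K"
    proof
      fix d assume "d \<in> set (map (\<lambda>c. x \<otimes> c \<otimes> inv x) cs)"
      then obtain c where "c \<in> set cs" "d = x \<otimes> c \<otimes> inv x" by auto
      then show "d \<in> derived_set G K"
        using derived_set_conj[OF subsetD[OF cs(2)] assms(2-4)] by blast
    qed
    show "x \<otimes> a \<otimes> inv x = list_product G (map (\<lambda>c. x \<otimes> c \<otimes> inv x) cs)"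
      using * cs by blast
  qed
qed

lemma commutator_mult_right:
  assumes "a \<in> carrier G" "b \<in> carrier G" "c \<in> carrier G"
  shows "a \<otimes> (b \<otimes> c) \<otimes> inv a \<otimes> inv (b \<otimes> c) =
    (a \<otimes> b \<otimes> inv a \<otimes> inv b) \<otimes> (b \<otimes> (a \<otimes> c \<otimes> inv a \<otimes> inv c) \<otimes> inv b)"
  using assms by (simp add: m_assoc inv_cancel_assoc inv_mult_group)

lemma commutator_mult_left:
  assumes "a \<in> carrier G" "b \<in> carrier G" "c \<in> carrier G"
  shows "(a \<otimes> b) \<otimes> c \<otimes> inv (a \<otimes> b) \<otimes> inv c =
    (a \<otimes> (b \<otimes> c \<otimes> inv b \<otimes> inv c) \<otimes> inv a) \<otimes> (a \<otimes> c \<otimes> inv a \<otimes> inv c)"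
  using assms by (simp add: m_assoc inv_cancel_assoc inv_mult_group)

text \<open>Induction on both lists with the two expansions above. Each expansion splits off one
  term and conjugates another by an element of \<open>H\<close>, which preserves \<open>K\<close>;
  in the end every pair from \<open>fs\<close> and \<open>gs\<close> contributes one
  commutator.\<close>

lemma commutator_product_commutator_list_product:
  assumes K: "K \<subseteq> carrier G" and H: "H \<subseteq> carrier G"
    and conj: "\<And>x k. x \<in> H \<Longrightarrow> k \<in> K \<Longrightarrow> x \<otimes> k \<otimes> inv x \<in> K"
    and "set fs \<subseteq> H" "set gs \<subseteq> H"
    and "\<And>f g. f \<in> set fs \<Longrightarrow> g \<in> set gs \<Longrightarrow> f \<otimes> g \<otimes> inv f \<otimes> inv g \<in> derived_set G K"
  shows "commutator_product G K (length fs * length gs)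
    (list_product G fs \<otimes> list_product G gs \<otimes> inv (list_product G fs) \<otimes> inv (list_product G gs))"
proof -
  \<comment> \<open>First the expansion in the second argument, for one fixed \<open>f\<close>; the
    outer induction on \<open>fs\<close> then adds \<open>length gs\<close> factors at a
    time.\<close>
  have single: "commutator_product G K (length gs)
      (f \<otimes> list_product G gs \<otimes> inv f \<otimes> inv (list_product G gs))"
    if "f \<in> H" "set gs \<subseteq> H" "\<And>g. g \<in> set gs \<Longrightarrow> f \<otimes> g \<otimes> inv f \<otimes> inv g \<in> derived_set G K" for f gs
    using that(2,3)
  proof (induction gs)
    case Nil
    then show ?case
      using commutator_product_Nil that(1) H by (simp add: list_product_def subset_iff)
  next
    case (Cons g gs)
    have car: "f \<in> carrier G" "g \<in> carrier G" "list_product G gs \<in> carrier G" "g \<in> H"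
      using that(1) Cons.prems(1) H list_product_closed[of gs] by auto
    have "f \<otimes> g \<otimes> inv f \<otimes> inv g \<in> derived_set G K"
      by (rule Cons.prems(2)) simp
    then have 1: "commutator_product G K 1 (f \<otimes> g \<otimes> inv f \<otimes> inv g)"
      by (rule commutator_product_single[OF _ K])
    have "commutator_product G K (length gs)
        (f \<otimes> list_product G gs \<otimes> inv f \<otimes> inv (list_product G gs))"
    proof (rule Cons.IH)
      show "f \<otimes> x \<otimes> inv f \<otimes> inv x \<in> derived_set G K" if "x \<in> set gs" for x
        by (rule Cons.prems(2)) (use that in simp)
    qed (use Cons.prems(1) in simp)
    from commutator_product_mult[OF 1 commutator_product_conj[OF this K car(2)] K] conj[OF car(4)]
    show ?case
      using commutator_mult_right[OF car(1-3)] by (simp add: list_product_def)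
  qed
  show ?thesis
    using assms(4,6)
  proof (induction fs)
    case Nil
    then show ?case
      using commutator_product_Nil H assms(5) list_product_closed[of gs]
      by (simp add: list_product_def)
  next
    case (Cons f fs)
    have car: "f \<in> carrier G" "list_product G fs \<in> carrier G" "list_product G gs \<in> carrier G" "f \<in> H"
      using assms(5) Cons.prems(1) H list_product_closed[of gs] list_product_closed[of fs] by auto
    have 1: "commutator_product G K (length gs)
        (f \<otimes> list_product G gs \<otimes> inv f \<otimes> inv (list_product G gs))"
    proof (rule single[OF car(4) assms(5)])
      show "f \<otimes> g \<otimes> inv f \<otimes> inv g \<in> derived_set G K" if "g \<in> set gs" for g
        by (rule Cons.prems(2)) (use that in simp_all)
    qed
    have "commutator_product G K (length fs * length gs)
      (list_product G fs \<otimes> list_product G gs \<otimes> inv (list_product G fs) \<otimes> inv (list_product G gs))"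
    proof (rule Cons.IH)
      show "x \<otimes> g \<otimes> inv x \<otimes> inv g \<in> derived_set G K" if "x \<in> set fs" "g \<in> set gs" for x g
        by (rule Cons.prems(2)) (use that in simp_all)
    qed (use Cons.prems(1) in simp)
    from commutator_product_mult[OF commutator_product_conj[OF this K car(1)] 1 K] conj[OF car(4)]
    show ?case
      using commutator_mult_left[OF car(1-3)] by (simp add: list_product_def add.commute)
  qed
qed

section \<open>Commutator length and uniform perfectness of the derived subgroup\<close>

lemma derived_imp_commutator_product:
  assumes "g \<in> derived G H" "H \<subseteq> carrier G"
  shows "\<exists>r. commutator_product G H r g"
  using assms(1) unfolding derived_def
proof (induction rule: generate.induct)
  case one
  then show ?case using commutator_product_Nil by blast
next
  case (incl h)
  then show ?case using commutator_product_single[OF _ assms(2)] by blast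
next
  case (inv h)
  then obtain a b where ab: "a \<in> H" "b \<in> H" "h = a \<otimes> b \<otimes> inv a \<otimes> inv b" by blast
  \<comment> \<open>The inverse of [a, b] is [b, a], so inverses of generators are again single
    commutators.\<close>
  then have "inv h = b \<otimes> a \<otimes> inv b \<otimes> inv a"
    using assms(2) by (simp add: subset_iff m_assoc inv_mult_group)
  then have "inv h \<in> derived_set G H" using ab by blast
  then show ?case using commutator_product_single[OF _ assms(2)] by blast
next
  case (eng h1 h2)
  then show ?case using commutator_product_mult[OF _ _ assms(2)] by blast
qed

text \<open>The minimum is attained because some product exists; the identity, of length 0 by
  convention, is the empty product.\<close>

lemma commutator_product_commutator_length:
  assumes "g \<in> derived G H" "H \<subseteq> carrier G"
  shows "commutator_product G H (commutator_length G H g) g"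
  using LeastI_ex[OF derived_imp_commutator_product[OF assms]] commutator_product_Nil
  by (simp add: commutator_length_def)

lemma commutator_product_imp_derived:
  assumes "commutator_product G H n g" "H \<subseteq> carrier G"
  shows "g \<in> derived G H"
proof -
  interpret D: subgroup "derived G H" G by (rule derived_is_subgroup[OF assms(2)])
  have "set cs \<subseteq> derived_set G H \<Longrightarrow> list_product G cs \<in> derived G H" for cs
  proof (induction cs)
    case Nil
    then show ?case by (simp add: list_product_def)
  next
    case (Cons c cs)
    have "c \<in> derived G H" "set cs \<subseteq> derived_set G H"
      using Cons.prems generate.incl[of c "derived_set G H" G] unfolding derived_def
      by (simp_all only: list.set insert_subset)
    then show ?case using Cons.IH by (simp add: list_product_def)
  qed
  then show ?thesis using assms(1) unfolding commutator_product_def by blast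
qed

text \<open>Normality of the derived subgroup is stated in the group with carrier \<open>H\<close>;
  \<open>m_inv_consistent\<close> identifies inverses there with those of \<open>G\<close>.\<close>

lemma derived_conj_closed:
  assumes "subgroup H G" "x \<in> H" "k \<in> derived G H"
  shows "x \<otimes> k \<otimes> inv x \<in> derived G H"
  using normal.inv_op_closed2[OF derived_subgroup_is_normal[OF assms(1)], of x k] assms
  by (simp add: m_inv_consistent)

text \<open>An element of the derived subgroup is a product of at most \<open>C\<close> commutators
  over \<open>H\<close>, each of which is a product of at most \<open>N\<close> commutators over the
  derived subgroup. This gives both the uniform bound and the nontrivial inclusion for
  perfectness.\<close>

lemma uniformly_perfect_derived:
  assumes H: "subgroup H G"
    and C: "\<And>g. g \<in> derived G H \<Longrightarrow> commutator_length G H g \<le> C"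
    and N: "\<And>f g. f \<in> H \<Longrightarrow> g \<in> H \<Longrightarrow>
      \<exists>n\<le>N. commutator_product G (derived G H) n (f \<otimes> g \<otimes> inv f \<otimes> inv g)"
  shows "uniformly_perfect G (derived G H)"
proof -
  let ?D = "derived G H"
  note Hc = subgroup.subset[OF H]
  note Dc = derived_in_carrier[OF Hc]
  \<comment> \<open>The extra 1 keeps the bound positive, as \<open>uniformly_perfect\<close>
    demands, even if \<open>C\<close> or \<open>N\<close> is 0.\<close>
  have *: "\<exists>n\<le>C * N + 1. commutator_product G ?D n g" if g: "g \<in> ?D" for g
  proof -
    have "\<exists>n\<le>commutator_length G H g * N. commutator_product G ?D n g"
      by (rule commutator_product_bind[OF commutator_product_commutator_length[OF g Hc] Dc])
        (use N in blast)
    moreover have "commutator_length G H g * N \<le> C * N + 1"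
      using C[OF g] by (simp add: le_SucI)
    ultimately show ?thesis by (meson order_trans)
  qed
  have "derived G ?D \<subseteq> ?D"
    by (rule derived_incl[OF subset_refl derived_is_subgroup[OF Hc]])
  moreover have "?D \<subseteq> derived G ?D"
    using * commutator_product_imp_derived[OF _ Dc] by blast
  ultimately show ?thesis
    unfolding uniformly_perfect_def using * by (metis add_gr_0 subset_antisym zero_less_one)
qed

lemma commutes_inv:
  assumes "x \<otimes> y = y \<otimes> x" "x \<in> carrier G" "y \<in> carrier G"
  shows "inv x \<otimes> y = y \<otimes> inv x"
  using assms by (metis inv_closed inv_solve_right' inv_solve_left m_assoc m_closed)

text \<open>Moved to the right end of the first product, \<open>a\<close> cancels against its
  inverse; then \<open>b\<close> passes \<open>inv f\<close> and cancels against
  \<open>inv b\<close>. In the application \<open>f \<otimes> a\<close> and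
  \<open>g \<otimes> b\<close> are themselves commutators.\<close>

lemma commutator_mult_commuting:
  assumes car: "f \<in> carrier G" "g \<in> carrier G" "a \<in> carrier G" "b \<in> carrier G"
    and com: "a \<otimes> f = f \<otimes> a" "a \<otimes> g = g \<otimes> a" "a \<otimes> b = b \<otimes> a" "b \<otimes> f = f \<otimes> b"
  shows "(f \<otimes> a) \<otimes> (g \<otimes> b) \<otimes> inv (f \<otimes> a) \<otimes> inv (g \<otimes> b) = f \<otimes> g \<otimes> inv f \<otimes> inv g"
proof -
  have "(f \<otimes> a) \<otimes> (g \<otimes> b) = f \<otimes> g \<otimes> b \<otimes> a"
    using car com by (metis m_assoc m_closed)
  then have "(f \<otimes> a) \<otimes> (g \<otimes> b) \<otimes> inv (f \<otimes> a) = f \<otimes> g \<otimes> (b \<otimes> inv f)"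
    using car by (simp add: m_assoc inv_cancel_assoc inv_mult_group)
  also have "b \<otimes> inv f = inv f \<otimes> b"
    using commutes_inv[of f b] com(4) car by simp
  finally show ?thesis
    using car by (simp add: m_assoc inv_cancel_assoc inv_mult_group)
qed

end

section \<open>Barycentric refinements\<close>

lemma closedin_locally_finite_image_Union:
  assumes "locally_finite_in X \<A>" "\<B> \<subseteq> \<A>"
  shows "closedin X (\<Union>B\<in>\<B>. X closure_of B)"
  using closedin_Union_locally_finite_closure[OF locally_finite_in_subset[OF assms]] by simp

text \<open>Regularity of paracompact Hausdorff spaces. The space is covered by \<open>U\<close> and
  by open sets whose closures miss \<open>x\<close>; from a locally finite refinement, the closures
  of all members not inside \<open>U\<close> are removed. Their union is closed and misses
  \<open>x\<close>.\<close>

lemma paracompact_space_shrink: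
  assumes X: "paracompact_space X" and U: "openin X U" "x \<in> U"
  obtains O' where "openin X O'" "x \<in> O'" "X closure_of O' \<subseteq> U"
proof -
  have x: "x \<in> topspace X" using U openin_subset by blast
  define \<U> where "\<U> = insert U {V. openin X V \<and> x \<notin> X closure_of V}"
  have "\<exists>V. openin X V \<and> y \<in> V \<and> x \<notin> X closure_of V" if y: "y \<in> topspace X" "y \<notin> U" for y
  proof -
    have "x \<noteq> y" using U y by blast
    then obtain A B where "openin X A" "openin X B" "x \<in> A" "y \<in> B" "disjnt A B"
      using X x y unfolding paracompact_space_def Hausdorff_space_def by blast
    then have "x \<notin> X closure_of B"
      unfolding in_closure_of disjnt_iff by blast
    then show ?thesis using \<open>openin X B\<close> \<open>y \<in> B\<close> by blast
  qed
  then have "topspace X \<subseteq> \<Union>\<U>" by (auto simp: \<U>_def)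
  moreover have "openin X V" if "V \<in> \<U>" for V using that U(1) by (auto simp: \<U>_def)
  ultimately have "open_cover X \<U>"
    unfolding open_cover_def using openin_subset by blast
  then obtain \<V> where V: "open_cover X \<V>" "\<forall>V\<in>\<V>. \<exists>U\<in>\<U>. V \<subseteq> U" "locally_finite_in X \<V>"
    using X unfolding paracompact_space_def by blast
  define \<B> where "\<B> = {V \<in> \<V>. \<not> V \<subseteq> U}"
  let ?F = "\<Union>B\<in>\<B>. X closure_of B"
  let ?O = "topspace X - ?F"
  have opn: "openin X ?O"
    using closedin_locally_finite_image_Union[OF V(3), of \<B>] by (auto simp: \<B>_def)
  have "x \<notin> X closure_of B" if B: "B \<in> \<B>" for B
  proof -
    obtain W where W: "W \<in> \<U>" "B \<subseteq> W" "W \<noteq> U" using B V(2) by (auto simp: \<B>_def)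
    then have "x \<notin> X closure_of W" by (auto simp: \<U>_def)
    then show ?thesis using W(2) closure_of_mono by (metis subsetD)
  qed
  then have "x \<in> ?O" using x by blast
  moreover have "X closure_of ?O \<subseteq> U"
  proof
    fix y assume y: "y \<in> X closure_of ?O"
    then have yX: "y \<in> topspace X" by (simp add: in_closure_of)
    then obtain V' where V': "V' \<in> \<V>" "y \<in> V'" using V(1) by (auto simp: open_cover_def)
    then have oV: "openin X V'" using V(1) by (auto simp: open_cover_def)
    then obtain z where "z \<in> V'" "z \<in> ?O" using y V' by (auto simp: in_closure_of)
    \<comment> \<open>An open member around a closure point of \<open>?O\<close> meets
      \<open>?O\<close>, so it was not among the removed sets and lies in \<open>U\<close>.\<close>
    then have "V' \<notin> \<B>" using closure_of_subset openin_subset[OF oV] by blast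
    then show "y \<in> U" using V' by (auto simp: \<B>_def)
  qed
  ultimately show ?thesis using that opn by blast
qed

text \<open>A locally finite cover \<open>\<P>\<close> is chosen whose closures lie in members of
  \<open>\<U>\<close>. The set \<open>W x\<close> records which closures contain \<open>x\<close>:
  it stays inside the members \<open>u P\<close> assigned to these and avoids all other
  closures.\<close>

lemma paracompact_space_barycentric:
  assumes X: "paracompact_space X" and \<U>: "open_cover X \<U>"
  obtains \<W> where "open_cover X \<W>"
    "\<And>A B. A \<in> \<W> \<Longrightarrow> B \<in> \<W> \<Longrightarrow> A \<inter> B \<noteq> {} \<Longrightarrow> \<exists>U\<in>\<U>. A \<union> B \<subseteq> U"
proof -
  define \<O> where "\<O> = {O'. openin X O' \<and> (\<exists>U\<in>\<U>. X closure_of O' \<subseteq> U)}"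
  have "\<exists>O'\<in>\<O>. x \<in> O'" if x: "x \<in> topspace X" for x
  proof -
    obtain U where U: "U \<in> \<U>" "x \<in> U" "openin X U"
      using \<U> x unfolding open_cover_def by blast
    obtain O' where "openin X O'" "x \<in> O'" "X closure_of O' \<subseteq> U"
      using paracompact_space_shrink[OF X U(3,2)] .
    then show ?thesis using U by (auto simp: \<O>_def)
  qed
  moreover have "O' \<subseteq> topspace X" if "O' \<in> \<O>" for O'
    using that openin_subset by (auto simp: \<O>_def)
  ultimately have "open_cover X \<O>"
    unfolding open_cover_def by (auto simp: \<O>_def)
  then obtain \<P> where P: "open_cover X \<P>" "\<forall>P\<in>\<P>. \<exists>O'\<in>\<O>. P \<subseteq> O'" "locally_finite_in X \<P>"
    using X unfolding paracompact_space_def by blast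
  have "\<exists>U\<in>\<U>. X closure_of P \<subseteq> U" if P': "P \<in> \<P>" for P
  proof -
    obtain O' where "O' \<in> \<O>" "P \<subseteq> O'" using P(2) P' by blast
    then show ?thesis unfolding \<O>_def using closure_of_mono[of P O' X] by blast
  qed
  then obtain u where u: "\<And>P. P \<in> \<P> \<Longrightarrow> u P \<in> \<U>" "\<And>P. P \<in> \<P> \<Longrightarrow> X closure_of P \<subseteq> u P"
    by metis
  define In where "In x = {P \<in> \<P>. x \<in> X closure_of P}" for x
  define W where "W x = (topspace X \<inter> \<Inter>(u ` In x)) - (\<Union>P\<in>\<P> - In x. X closure_of P)" for x
  have fin: "finite (In x)" if x: "x \<in> topspace X" for x
  proof -
    obtain V where V: "openin X V" "x \<in> V" "finite {U \<in> \<P>. U \<inter> V \<noteq> {}}"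
      using P(3) x unfolding locally_finite_in_def by blast
    \<comment> \<open>Every set whose closure contains \<open>x\<close> meets the neighbourhood
      \<open>V\<close>, so local finiteness bounds \<open>In x\<close>.\<close>
    have "In x \<subseteq> {U \<in> \<P>. U \<inter> V \<noteq> {}}"
      using V(1,2) by (auto simp: In_def in_closure_of)
    then show ?thesis using V(3) finite_subset by blast
  qed
  have opn: "openin X (W x)" if x: "x \<in> topspace X" for x
  proof -
    have "openin X (topspace X \<inter> \<Inter>(u ` In x))"
    proof (rule openin_Int_Inter)
      show "finite (u ` In x)" using fin[OF x] by simp
      show "openin X (topspace X)" by simp
      show "openin X S" if "S \<in> u ` In x" for S
        using that u(1) \<U> by (auto simp: In_def open_cover_def)
    qed
    moreover have "closedin X (\<Union>P\<in>\<P> - In x. X closure_of P)"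
      by (rule closedin_locally_finite_image_Union[OF P(3)]) blast
    ultimately show ?thesis unfolding W_def by blast
  qed
  have mem: "x \<in> W x" if "x \<in> topspace X" for x
    using that u(2) by (auto simp: W_def In_def)
  show ?thesis
  proof (rule that[of "W ` topspace X"])
    show "open_cover X (W ` topspace X)"
      using opn mem by (auto simp: open_cover_def W_def)
  next
    fix A B assume "A \<in> W ` topspace X" "B \<in> W ` topspace X" "A \<inter> B \<noteq> {}"
    then obtain a b y where ab: "A = W a" "B = W b" "y \<in> W a" "y \<in> W b" by blast
    then have "y \<in> topspace X" by (simp add: W_def)
    then obtain P' where P': "P' \<in> \<P>" "y \<in> P'" "openin X P'" using P(1) by (auto simp: open_cover_def)
    then have "y \<in> X closure_of P'" using closure_of_subset openin_subset by (metis subsetD)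
    \<comment> \<open>Otherwise the closure of \<open>P'\<close>, which contains \<open>y\<close>,
      would have been removed from \<open>W a\<close> or \<open>W b\<close>. Hence
      \<open>u P'\<close> is a common bound for both sets.\<close>
    then have "P' \<in> In a" "P' \<in> In b" using ab P'(1) by (auto simp: W_def)
    then have "W a \<union> W b \<subseteq> u P'" by (auto simp: W_def)
    then show "\<exists>U\<in>\<U>. A \<union> B \<subseteq> U" using u(1) P'(1) ab by blast
  qed
qed

section \<open>Groups of homeomorphisms\<close>

text \<open>The support before taking the closure. Disjointness and conjugation are argued with this
  set, and \<open>moved_subset_supp\<close> links it to \<open>supp\<close>.\<close>

abbreviation moved :: "'a topology \<Rightarrow> ('a \<Rightarrow> 'a) \<Rightarrow> 'a set" where
  "moved X f \<equiv> {x \<in> topspace X. f x \<noteq> x}"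

text \<open>Two displacing elements serve the two entries of a commutator; the two translates must
  also be disjoint from each other so that the displaced copies commute.\<close>

definition doubly_displaceable :: "('a \<Rightarrow> 'a) set \<Rightarrow> 'a set \<Rightarrow> bool" where
  "doubly_displaceable G V \<longleftrightarrow>
     (\<exists>h\<in>G. \<exists>k\<in>G. V \<inter> h ` V = {} \<and> V \<inter> k ` V = {} \<and> h ` V \<inter> k ` V = {})"

lemma moved_subset_supp: "moved X f \<subseteq> supp X f"
  unfolding supp_def by (rule closure_of_subset) auto

context
  fixes X :: "'a topology"
begin

interpretation group "homeo_group X" by (rule group_homeo_group)

section \<open>Pointwise calculus of homeomorphisms\<close>

lemma homeo_group_carrierD:
  assumes "f \<in> carrier (homeo_group X)"
  shows "f \<in> extensional (topspace X)" "bij_betw f (topspace X) (topspace X)"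
    "continuous_map X X f" "homeomorphic_map X X f"
  using assms homeomorphic_imp_continuous_map by (auto simp: homeo_group_def Bij_def)

lemma homeo_group_in_topspace:
  assumes "f \<in> carrier (homeo_group X)" "x \<in> topspace X"
  shows "f x \<in> topspace X"
  using homeo_group_carrierD(2)[OF assms(1)] assms(2) bij_betwE by blast

lemma homeo_group_inj:
  assumes "f \<in> carrier (homeo_group X)" "x \<in> topspace X" "y \<in> topspace X" "f x = f y"
  shows "x = y"
  using homeo_group_carrierD(2)[OF assms(1)] assms by (meson bij_betw_def inj_onD)

lemma homeo_group_mult_apply:
  assumes "f \<in> carrier (homeo_group X)" "g \<in> carrier (homeo_group X)" "x \<in> topspace X"
  shows "(f \<otimes>\<^bsub>homeo_group X\<^esub> g) x = f (g x)"
  using assms by (simp add: homeo_group_def BijGroup_def compose_def)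

lemma homeo_group_one_apply: "x \<in> topspace X \<Longrightarrow> \<one>\<^bsub>homeo_group X\<^esub> x = x"
  by (simp add: homeo_group_def BijGroup_def)

lemma homeo_group_eqI:
  assumes "f \<in> carrier (homeo_group X)" "g \<in> carrier (homeo_group X)"
    "\<And>x. x \<in> topspace X \<Longrightarrow> f x = g x"
  shows "f = g"
  using homeo_group_carrierD(1)[OF assms(1)] homeo_group_carrierD(1)[OF assms(2)] assms(3)
  by (rule extensionalityI)

lemma homeo_group_inv_apply:
  assumes "f \<in> carrier (homeo_group X)" "x \<in> topspace X"
  shows "f ((inv\<^bsub>homeo_group X\<^esub> f) x) = x" "(inv\<^bsub>homeo_group X\<^esub> f) (f x) = x"
  using homeo_group_mult_apply[of f "inv\<^bsub>homeo_group X\<^esub> f" x]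
    homeo_group_mult_apply[of "inv\<^bsub>homeo_group X\<^esub> f" f x] homeo_group_one_apply assms by simp_all

lemma moved_inv:
  assumes "f \<in> carrier (homeo_group X)"
  shows "moved X (inv\<^bsub>homeo_group X\<^esub> f) \<subseteq> moved X f"
  using homeo_group_inv_apply[OF assms] by force

lemma moved_conj:
  assumes "f \<in> carrier (homeo_group X)" "h \<in> carrier (homeo_group X)"
  shows "moved X (h \<otimes>\<^bsub>homeo_group X\<^esub> f \<otimes>\<^bsub>homeo_group X\<^esub> inv\<^bsub>homeo_group X\<^esub> h) \<subseteq> h ` moved X f"
proof clarify
  fix x assume x: "x \<in> topspace X"
    "(h \<otimes>\<^bsub>homeo_group X\<^esub> f \<otimes>\<^bsub>homeo_group X\<^esub> inv\<^bsub>homeo_group X\<^esub> h) x \<noteq> x"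
  let ?y = "(inv\<^bsub>homeo_group X\<^esub> h) x"
  have y: "?y \<in> topspace X" using homeo_group_in_topspace assms x by simp
  have "h (f ?y) \<noteq> x"
    using x y assms homeo_group_mult_apply by simp
  then have "f ?y \<noteq> ?y" using homeo_group_inv_apply(1)[OF assms(2) x(1)] by auto
  then show "x \<in> h ` moved X f"
    using y homeo_group_inv_apply(1)[OF assms(2) x(1)] by (metis (mono_tags, lifting) imageI mem_Collect_eq)
qed

text \<open>If \<open>g\<close> moves \<open>x\<close>, then by injectivity it also moves
  \<open>g x\<close>, so \<open>f\<close> fixes both points and the two composites send
  \<open>x\<close> to \<open>g x\<close>. The case where \<open>f\<close> moves \<open>x\<close> is
  symmetric.\<close>

lemma homeo_group_commute:
  assumes "f \<in> carrier (homeo_group X)" "g \<in> carrier (homeo_group X)" "moved X f \<inter> moved X g = {}"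
  shows "f \<otimes>\<^bsub>homeo_group X\<^esub> g = g \<otimes>\<^bsub>homeo_group X\<^esub> f"
proof (rule homeo_group_eqI)
  fix x assume x: "x \<in> topspace X"
  have D: "f y = y \<or> g y = y" if "y \<in> topspace X" for y
    using assms(3) that by blast
  have "f (g x) = g (f x)"
    using D[OF x] D[of "f x"] D[of "g x"] homeo_group_inj[OF assms(1)] homeo_group_inj[OF assms(2)]
      homeo_group_in_topspace assms(1,2) x by metis
  then show "(f \<otimes>\<^bsub>homeo_group X\<^esub> g) x = (g \<otimes>\<^bsub>homeo_group X\<^esub> f) x"
    using homeo_group_mult_apply assms(1,2) x by simp
qed (use assms in auto)

text \<open>The conjugates \<open>a\<close> of \<open>inv f\<close> by \<open>h\<close> and
  \<open>b\<close> of \<open>inv g\<close> by \<open>k\<close> move only points of \<open>h\<close>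
  V\<open>and\<close>k \<open>V\<close>. Multiplying \<open>f\<close> by \<open>a\<close> and
  \<open>g\<close> by \<open>b\<close> yields [f, h] and [g, k] without changing the commutator of
  \<open>f\<close> and \<open>g\<close>.\<close>

lemma commutator_displaced:
  assumes G: "subgroup G (homeo_group X)" and fg: "f \<in> G" "g \<in> G" and hk: "h \<in> G" "k \<in> G"
    and V: "moved X f \<subseteq> V" "moved X g \<subseteq> V"
    and disj: "V \<inter> h ` V = {}" "V \<inter> k ` V = {}" "h ` V \<inter> k ` V = {}"
  shows "f \<otimes>\<^bsub>homeo_group X\<^esub> g \<otimes>\<^bsub>homeo_group X\<^esub> inv\<^bsub>homeo_group X\<^esub> f \<otimes>\<^bsub>homeo_group X\<^esub> inv\<^bsub>homeo_group X\<^esub> g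
    \<in> derived_set (homeo_group X) (derived (homeo_group X) G)"
proof -
  let ?M = "homeo_group X"
  define a where "a = h \<otimes>\<^bsub>?M\<^esub> inv\<^bsub>?M\<^esub> f \<otimes>\<^bsub>?M\<^esub> inv\<^bsub>?M\<^esub> h"
  define b where "b = k \<otimes>\<^bsub>?M\<^esub> inv\<^bsub>?M\<^esub> g \<otimes>\<^bsub>?M\<^esub> inv\<^bsub>?M\<^esub> k"
  have car: "f \<in> carrier ?M" "g \<in> carrier ?M" "h \<in> carrier ?M" "k \<in> carrier ?M"
    using subgroup.subset[OF G] fg hk by auto
  then have abc: "a \<in> carrier ?M" "b \<in> carrier ?M" by (simp_all add: a_def b_def)
  have "moved X a \<subseteq> h ` V" "moved X b \<subseteq> k ` V"
    unfolding a_def b_def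
    using moved_conj[of "inv\<^bsub>?M\<^esub> f" h] moved_conj[of "inv\<^bsub>?M\<^esub> g" k] moved_inv[of f] moved_inv[of g] V car
    by (meson image_mono inv_closed subset_trans)+
  then have com: "a \<otimes>\<^bsub>?M\<^esub> f = f \<otimes>\<^bsub>?M\<^esub> a" "a \<otimes>\<^bsub>?M\<^esub> g = g \<otimes>\<^bsub>?M\<^esub> a"
    "a \<otimes>\<^bsub>?M\<^esub> b = b \<otimes>\<^bsub>?M\<^esub> a" "b \<otimes>\<^bsub>?M\<^esub> f = f \<otimes>\<^bsub>?M\<^esub> b"
    using V disj by (intro homeo_group_commute car abc; blast)+
  have "f \<otimes>\<^bsub>?M\<^esub> a = f \<otimes>\<^bsub>?M\<^esub> h \<otimes>\<^bsub>?M\<^esub> inv\<^bsub>?M\<^esub> f \<otimes>\<^bsub>?M\<^esub> inv\<^bsub>?M\<^esub> h"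
    "g \<otimes>\<^bsub>?M\<^esub> b = g \<otimes>\<^bsub>?M\<^esub> k \<otimes>\<^bsub>?M\<^esub> inv\<^bsub>?M\<^esub> g \<otimes>\<^bsub>?M\<^esub> inv\<^bsub>?M\<^esub> k"
    using car by (simp_all add: a_def b_def m_assoc)
  then have "f \<otimes>\<^bsub>?M\<^esub> a \<in> derived_set ?M G" "g \<otimes>\<^bsub>?M\<^esub> b \<in> derived_set ?M G"
    using fg hk by blast+
  then have D: "f \<otimes>\<^bsub>?M\<^esub> a \<in> derived ?M G" "g \<otimes>\<^bsub>?M\<^esub> b \<in> derived ?M G"
    unfolding derived_def by (simp_all only: generate.incl)
  show ?thesis
    \<comment> \<open>The goal is rewritten backwards into the commutator of
      \<open>f \<otimes> a\<close> and \<open>g \<otimes> b\<close>; \<open>derived_set\<close> is a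
      double union of singletons, whence the \<open>UN_I\<close> rules.\<close>
    unfolding commutator_mult_commuting[OF car(1,2) abc com, symmetric]
    by (rule UN_I, rule D(1), rule UN_I, rule D(2), rule singletonI)
qed

section \<open>Orbits of three points and displaceable neighbourhoods\<close>

lemma list_product_fixes:
  assumes "set gs \<subseteq> carrier (homeo_group X)" "x \<in> topspace X" "\<forall>g\<in>set gs. g x = x"
  shows "list_product (homeo_group X) gs x = x"
  using assms(1,3)
proof (induction gs)
  case Nil
  then show ?case using homeo_group_one_apply assms(2) by (simp add: list_product_def)
next
  case (Cons g gs)
  then have "(g \<otimes>\<^bsub>homeo_group X\<^esub> list_product (homeo_group X) gs) x = x"
    using homeo_group_mult_apply[OF _ list_product_closed assms(2)] by simp
  then show ?case by (simp add: list_product_def)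
qed

text \<open>Fragmenting an \<open>h\<close> that moves \<open>x\<close> along the complements of
  \<open>x\<close> and of \<open>h x\<close> produces a factor \<open>k\<close> that moves
  \<open>x\<close>. Its support contains \<open>x\<close>, hence avoids \<open>h x\<close>; so
  \<open>k\<close> fixes \<open>h x\<close>, and injectivity separates \<open>k x\<close> from
  \<open>h x\<close>.\<close>

lemma three_point_orbit:
  assumes X: "Hausdorff_space X" and G: "subgroup G (homeo_group X)" and "factorizable X G"
    and "non_fixing X G" and x: "x \<in> topspace X"
  obtains h k where "h \<in> G" "k \<in> G" "h x \<noteq> x" "k x \<noteq> x" "h x \<noteq> k x"
proof -
  note Gc = subgroup.subset[OF G]
  have "(\<lambda>g. g x) ` G \<noteq> {x}" "G \<noteq> {}"
    using assms(4) x subgroup.one_closed[OF G] unfolding non_fixing_def by blast+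
  \<comment> \<open>If all of \<open>G\<close> fixed \<open>x\<close>, the orbit would be the image
    of a nonempty set under a constant map, that is \<open>{x}\<close>.\<close>
  moreover have "(\<lambda>g. g x) ` G = (\<lambda>g. x) ` G" if "\<forall>g\<in>G. g x = x"
    using that by (intro image_cong) auto
  ultimately obtain h where h: "h \<in> G" "h x \<noteq> x" by (metis image_constant_conv)
  then have hX: "h x \<in> topspace X" using Gc homeo_group_in_topspace x by blast
  let ?\<U> = "{topspace X - {x}, topspace X - {h x}}"
  have "openin X (topspace X - {z})" if "z \<in> topspace X" for z
    using that X by (simp add: closedin_Hausdorff_singleton openin_diff)
  then have "open_cover X ?\<U>" using x hX h by (auto simp: open_cover_def)
  then obtain gs where gs: "is_fragmentation X G ?\<U> gs h"
    using assms(3) h(1) unfolding factorizable_def cover_factorizable_def by blast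
  then have "list_product (homeo_group X) gs x \<noteq> x" "set gs \<subseteq> carrier (homeo_group X)"
    using h Gc by (auto simp: is_fragmentation_def)
  then obtain k where k: "k \<in> set gs" "k x \<noteq> x" using list_product_fixes x by blast
  then have kG: "k \<in> G" and "supp X k \<subseteq> topspace X - {x} \<or> supp X k \<subseteq> topspace X - {h x}"
    using gs by (auto simp: is_fragmentation_def)
  then have "k (h x) = h x" using moved_subset_supp[of X k] k x hX by blast
  then have "k x \<noteq> h x" using homeo_group_inj[of k x "h x"] kG Gc x hX h(2) by auto
  then show ?thesis using that h kG k by metis
qed

text \<open>The three points \<open>x\<close>, \<open>h x\<close>, \<open>k x\<close> are separated
  pairwise by open sets, which are pulled back along \<open>h\<close> and \<open>k\<close> by
  continuity.\<close>

lemma displaceable_neighbourhood: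
  assumes X: "Hausdorff_space X" and G: "subgroup G (homeo_group X)" and "factorizable X G"
    and "non_fixing X G" and x: "x \<in> topspace X"
  obtains V where "openin X V" "x \<in> V" "doubly_displaceable G V"
proof -
  note Gc = subgroup.subset[OF G]
  obtain h k where hk: "h \<in> G" "k \<in> G" "h x \<noteq> x" "k x \<noteq> x" "h x \<noteq> k x"
    using three_point_orbit[OF assms] .
  then have car: "h \<in> carrier (homeo_group X)" "k \<in> carrier (homeo_group X)" using Gc by auto
  have top: "h x \<in> topspace X" "k x \<in> topspace X" using car homeo_group_in_topspace x by auto
  have sep: "\<exists>A B. openin X A \<and> openin X B \<and> p \<in> A \<and> q \<in> B \<and> A \<inter> B = {}"
    if "p \<in> topspace X" "q \<in> topspace X" "p \<noteq> q" for p q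
    using X that unfolding Hausdorff_space_def disjnt_def by blast
  obtain A1 B1 where 1: "openin X A1" "openin X B1" "x \<in> A1" "h x \<in> B1" "A1 \<inter> B1 = {}"
    using sep[of x "h x"] x top hk by metis
  obtain A2 B2 where 2: "openin X A2" "openin X B2" "x \<in> A2" "k x \<in> B2" "A2 \<inter> B2 = {}"
    using sep[of x "k x"] x top hk by metis
  obtain A3 B3 where 3: "openin X A3" "openin X B3" "h x \<in> A3" "k x \<in> B3" "A3 \<inter> B3 = {}"
    using sep[of "h x" "k x"] x top hk by metis
  define V where
    "V = (A1 \<inter> A2) \<inter> ({y \<in> topspace X. h y \<in> B1 \<inter> A3} \<inter> {y \<in> topspace X. k y \<in> B2 \<inter> B3})"
  have V: "openin X V"
    unfolding V_def
    by (intro openin_Int openin_continuous_map_preimage[where Y = X] homeo_group_carrierD car 1 2 3)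
  have xV: "x \<in> V" unfolding V_def using x 1 2 3 by blast
  have sub: "V \<subseteq> A1" "V \<subseteq> A2" "h ` V \<subseteq> B1" "h ` V \<subseteq> A3" "k ` V \<subseteq> B2" "k ` V \<subseteq> B3"
    by (auto simp: V_def)
  have disj: "P \<inter> Q = {}" if "P \<subseteq> A" "Q \<subseteq> B" "A \<inter> B = {}" for P Q A B :: "'a set"
    using that by blast
  have "V \<inter> h ` V = {}" "V \<inter> k ` V = {}" "h ` V \<inter> k ` V = {}"
    using disj[OF sub(1,3) 1(5)] disj[OF sub(2,5) 2(5)] disj[OF sub(4,6) 3(5)] .
  then have "doubly_displaceable G V"
    unfolding doubly_displaceable_def using hk(1,2) by (intro bexI conjI)
  with V xV show ?thesis by (rule that)
qed

section \<open>Commutators of fragmented homeomorphisms\<close>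

lemma frag_fragmentation:
  assumes "cover_factorizable X G \<U>" "g \<in> G"
  obtains gs where "length gs = frag X G \<U> g" "is_fragmentation X G \<U> gs g"
proof (cases "g = \<one>\<^bsub>homeo_group X\<^esub>")
  case True
  then show ?thesis
    \<comment> \<open>The value 0 for the identity is realised by the empty list.\<close>
    using that[of "[]"] by (simp add: frag_def is_fragmentation_def list_product_def)
next
  case False
  obtain gs where gs: "is_fragmentation X G \<U> gs g"
    using assms unfolding cover_factorizable_def by blast
  \<comment> \<open>This makes the length positive, as the \<open>LEAST\<close> in
    \<open>frag\<close> requires.\<close>
  have "gs \<noteq> []" using gs False by (auto simp: is_fragmentation_def list_product_def)
  then have "\<exists>\<rho>>0. \<exists>gs. length gs = \<rho> \<and> is_fragmentation X G \<U> gs g"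
    using gs by (intro exI[of _ "length gs"]) auto
  from LeastI_ex[OF this] show ?thesis using that False by (auto simp: frag_def)
qed

lemma fragments_commutator:
  assumes G: "subgroup G (homeo_group X)" and fg: "f \<in> G" "g \<in> G"
    and supp: "supp X f \<subseteq> A" "supp X g \<subseteq> B"
    and meet: "A \<inter> B \<noteq> {} \<Longrightarrow> \<exists>V. A \<union> B \<subseteq> V \<and> doubly_displaceable G V"
  shows "f \<otimes>\<^bsub>homeo_group X\<^esub> g \<otimes>\<^bsub>homeo_group X\<^esub> inv\<^bsub>homeo_group X\<^esub> f \<otimes>\<^bsub>homeo_group X\<^esub> inv\<^bsub>homeo_group X\<^esub> g
    \<in> derived_set (homeo_group X) (derived (homeo_group X) G)"
proof (cases "A \<inter> B = {}")
  case True
  let ?M = "homeo_group X"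
  have car: "f \<in> carrier ?M" "g \<in> carrier ?M" using fg subgroup.subset[OF G] by auto
  have "f \<otimes>\<^bsub>?M\<^esub> g = g \<otimes>\<^bsub>?M\<^esub> f"
    using True supp moved_subset_supp[of X f] moved_subset_supp[of X g]
    by (intro homeo_group_commute car) blast
  then have "f \<otimes>\<^bsub>?M\<^esub> g \<otimes>\<^bsub>?M\<^esub> inv\<^bsub>?M\<^esub> f \<otimes>\<^bsub>?M\<^esub> inv\<^bsub>?M\<^esub> g = \<one>\<^bsub>?M\<^esub>"
    using car by (simp add: m_assoc inv_cancel_assoc)
  moreover have "\<one>\<^bsub>?M\<^esub> \<in> derived ?M G"
    by (simp add: derived_def generate.one)
  \<comment> \<open>The identity is the commutator of the identity with itself.\<close>
  ultimately show ?thesis by force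
next
  case False
  then obtain V where V: "A \<union> B \<subseteq> V" "doubly_displaceable G V" using meet by blast
  then obtain h k where hk: "h \<in> G" "k \<in> G"
    and disj: "V \<inter> h ` V = {}" "V \<inter> k ` V = {}" "h ` V \<inter> k ` V = {}"
    unfolding doubly_displaceable_def by (elim bexE conjE)
  have "moved X f \<subseteq> V" "moved X g \<subseteq> V"
    using V(1) supp moved_subset_supp[of X f] moved_subset_supp[of X g] by blast+
  from commutator_displaced[OF G fg hk this disj] show ?thesis .
qed

lemma commutator_product_bounded_frag:
  assumes G: "subgroup G (homeo_group X)" and fg: "f \<in> G" "g \<in> G"
    and \<W>: "cover_factorizable X G \<W>" "frag X G \<W> f \<le> N" "frag X G \<W> g \<le> N"
    and meet: "\<And>A B. A \<in> \<W> \<Longrightarrow> B \<in> \<W> \<Longrightarrow> A \<inter> B \<noteq> {} \<Longrightarrow> \<exists>V. A \<union> B \<subseteq> V \<and> doubly_displaceable G V"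
  shows "\<exists>n\<le>N * N. commutator_product (homeo_group X) (derived (homeo_group X) G) n
    (f \<otimes>\<^bsub>homeo_group X\<^esub> g \<otimes>\<^bsub>homeo_group X\<^esub> inv\<^bsub>homeo_group X\<^esub> f \<otimes>\<^bsub>homeo_group X\<^esub> inv\<^bsub>homeo_group X\<^esub> g)"
proof -
  note Gc = subgroup.subset[OF G]
  obtain fs where fs: "length fs = frag X G \<W> f" "is_fragmentation X G \<W> fs f"
    using frag_fragmentation[OF \<W>(1) fg(1)] .
  obtain gs where gs: "length gs = frag X G \<W> g" "is_fragmentation X G \<W> gs g"
    using frag_fragmentation[OF \<W>(1) fg(2)] .
  have "commutator_product (homeo_group X) (derived (homeo_group X) G) (length fs * length gs)
    (list_product (homeo_group X) fs \<otimes>\<^bsub>homeo_group X\<^esub> list_product (homeo_group X) gs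
      \<otimes>\<^bsub>homeo_group X\<^esub> inv\<^bsub>homeo_group X\<^esub> (list_product (homeo_group X) fs)
      \<otimes>\<^bsub>homeo_group X\<^esub> inv\<^bsub>homeo_group X\<^esub> (list_product (homeo_group X) gs))"
  proof (rule commutator_product_commutator_list_product[OF derived_in_carrier[OF Gc] Gc])
    show sub: "set fs \<subseteq> G" "set gs \<subseteq> G" using fs gs by (auto simp: is_fragmentation_def)
    fix f' g' assume f'g': "f' \<in> set fs" "g' \<in> set gs"
    then obtain A B where AB: "A \<in> \<W>" "B \<in> \<W>" "supp X f' \<subseteq> A" "supp X g' \<subseteq> B"
      using fs gs unfolding is_fragmentation_def by metis
    show "f' \<otimes>\<^bsub>homeo_group X\<^esub> g' \<otimes>\<^bsub>homeo_group X\<^esub> inv\<^bsub>homeo_group X\<^esub> f' \<otimes>\<^bsub>homeo_group X\<^esub> inv\<^bsub>homeo_group X\<^esub> g'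
      \<in> derived_set (homeo_group X) (derived (homeo_group X) G)"
      using f'g' sub by (intro fragments_commutator[OF G _ _ AB(3,4) meet[OF AB(1,2)]]) auto
  qed (rule derived_conj_closed[OF G])
  moreover have "length fs * length gs \<le> N * N" using fs gs \<W> by (simp add: mult_le_mono)
  ultimately show ?thesis using fs(2) gs(2) by (auto simp: is_fragmentation_def)
qed

end

theorem theorem1p3:
  fixes X :: "'a topology" and G :: "('a \<Rightarrow> 'a) set"
  assumes "paracompact_space X"
    and "subgroup G (homeo_group X)"
    and "factorizable X G"
    and "non_fixing X G"
    and "\<exists>N. \<forall>g\<in>derived (homeo_group X) G. commutator_length (homeo_group X) G g \<le> N"
    and "\<And>\<U>. open_cover X \<U> \<Longrightarrow> \<exists>N. \<forall>g\<in>G. frag X G \<U> g \<le> N"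
  shows "uniformly_perfect (homeo_group X) (derived (homeo_group X) G)"
proof -
  have haus: "Hausdorff_space X" using assms(1) by (simp add: paracompact_space_def)
  have "\<exists>V. openin X V \<and> doubly_displaceable G V \<and> x \<in> V" if "x \<in> topspace X" for x
    using displaceable_neighbourhood[OF haus assms(2-4) that] by metis
  \<comment> \<open>Every point has a doubly displaceable open neighbourhood; a barycentric
    refinement puts any two meeting members into a common one.\<close>
  then have "open_cover X {V. openin X V \<and> doubly_displaceable G V}"
    unfolding open_cover_def using openin_subset by auto
  then obtain \<W> where \<W>: "open_cover X \<W>"
    "\<And>A B. A \<in> \<W> \<Longrightarrow> B \<in> \<W> \<Longrightarrow> A \<inter> B \<noteq> {} \<Longrightarrow>
      \<exists>V\<in>{V. openin X V \<and> doubly_displaceable G V}. A \<union> B \<subseteq> V"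
    using paracompact_space_barycentric[OF assms(1)] by metis
  obtain C where C: "\<And>g. g \<in> derived (homeo_group X) G \<Longrightarrow> commutator_length (homeo_group X) G g \<le> C"
    using assms(5) by blast
  \<comment> \<open>The bound is taken for this one cover \<open>\<W>\<close>, so \<open>N\<close>
    is the same for all pairs \<open>f\<close>, \<open>g\<close> and \<open>N * N\<close> bounds
    their commutators uniformly.\<close>
  obtain N where N: "\<And>g. g \<in> G \<Longrightarrow> frag X G \<W> g \<le> N"
    using assms(6)[OF \<W>(1)] by blast
  have \<W>f: "cover_factorizable X G \<W>" using assms(3) \<W>(1) by (simp add: factorizable_def)
  have meet: "\<exists>V. A \<union> B \<subseteq> V \<and> doubly_displaceable G V" if "A \<in> \<W>" "B \<in> \<W>" "A \<inter> B \<noteq> {}" for A B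
    using \<W>(2)[OF that] by blast
  show ?thesis
    by (rule group.uniformly_perfect_derived[OF group_homeo_group assms(2) C])
      (use commutator_product_bounded_frag[OF assms(2) _ _ \<W>f N N meet] in blast)+
qed

end
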